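(* Let $f,r,\mathrm{B},\mathrm{D},\mathrm{d}$ and $F,R,\mathbf{D},\mathbf{d},\mathcal{L},\mathcal{W}^*$ be as in the context, let $\mathbf{J}=\mathbf{Q}-\alpha\mathbf{D}\mathbf{D}^{\top}$, and let $\mathbf{W}^k=(\mathbf{X}^k,\mathbf{\Lambda}^k)$, $k\ge 0$, be generated from an arbitrary $\mathbf{X}^0\in\mathcal{X}$ and $\mathbf{\Lambda}^0=0$ by \begin{align*} \bar{\mathbf{X}}^{k}&=\mathrm{prox}^{\alpha}_{R}\big(\mathbf{X}^{k}-\alpha(\mathbf{D}^{\top}\mathbf{\Lambda}^{k}+\nabla F(\mathbf{X}^{k}))\big),\\ \mathbf{\Lambda}^{k+1}&=\arg\min_{\mathbf{\Lambda}\in\mathcal{Y}}\Big\{\tfrac12\|\mathbf{\Lambda}-\mathbf{\Lambda}^k\|^2_{\mathbf{Q}}+\langle\mathbf{\Lambda},\mathbf{d}-\mathbf{D}\bar{\mathbf{X}}^k\rangle\Big\},\\ \mathbf{X}^{k+1}&=\bar{\mathbf{X}}^{k}+\alpha\mathbf{D}^{\top}(\mathbf{\Lambda}^k-\mathbf{\Lambda}^{k+1}). \end{align*} If $\alpha\in(0,2/L)$ and $\mathbf{J}\succ0$, then for any $\mathbf{W}^*\in\mathcal{W}^*$ the sequence $\{\|\mathbf{W}^k-\mathbf{W}^*\|\}_{k\ge0}$ is bounded. Moreover, there exists $\mathbf{W}^{\infty}\in\mathcal{W}^*$ such that $\lim_{k\to\infty}\mathbf{W}^k=\mathbf{W}^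{\infty}$.
   Context: Problem: $\min_{\mathrm{x}\in\mathbb{R}^n} f(\mathrm{x})+r(\mathrm{B}\mathrm{x})+\delta_0(\mathrm{D}\mathrm{x}-\mathrm{d})$, where $\mathrm{B}\in\mathbb{R}^{p_1\times n}$, $\mathrm{D}\in\mathbb{R}^{p_2\times n}$, $\mathrm{d}\in\mathbb{R}^{p_2}$, and $\delta_0(z)=0$ if $z=0$, $+\infty$ otherwise. Standing assumptions: the solution set is nonempty; $f:\mathbb{R}^n\to\mathbb{R}$ is convex and differentiable with $L$-Lipschitz gradient ($L>0$); $r:\mathbb{R}^{p_1}\to(-\infty,+\infty]$ is proper, closed and convex. Reformulation: $\mathcal{X}=\mathbb{R}^{n+p_1}$, $\mathcal{Y}=\mathbb{R}^{p_2+p_1}$, $\mathcal{W}=\mathcal{X}\times\mathcal{Y}$; for $\mathbf{X}=(\mathrm{x},\mathrm{y})\in\mathcal{X}$ put $F(\mathbf{X})=f(\mathrm{x})$, $R(\mathbf{X})=r(\mathrm{y})$, $\mathbf{D}\mathbf{X}=(\mathrm{D}\mathrm{x},\mathrm{B}\mathrm{x}-\mathrm{y})\in\mathcal{Y}$, and $\mathbf{d}=(\mathrm{d},0)\in\mathcal{Y}$. The Lagrangian is $\mathcal{L}(\mathbf{X},\mathbf{\Lambda})=F(\mathbf{X})+R(\mathbf{X})+\langle\mathbf{\Lambda},\mathbf{D}\mathbf{X}-\mathbf{d}\rangle$ on $\mathcal{W}$, and $\mathcal{W}^*$ is the set of its saddle points, i.e. of $(\mathbf{X}^*,\mathbf{\Lambda}^*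 )$ with $\mathcal{L}(\mathbf{X}^*,\mathbf{\Lambda})\le\mathcal{L}(\mathbf{X}^*,\mathbf{\Lambda}^* )\le\mathcal{L}(\mathbf{X},\mathbf{\Lambda}^* )$ for all $(\mathbf{X},\mathbf{\Lambda})\in\mathcal{W}$. Strong duality is assumed: $\mathcal{W}^*\neq\emptyset$. $\mathbf{Q}$ is a given self-adjoint linear operator on $\mathcal{Y}$. For a self-adjoint $H$, $\|x\|_H^2=\langle x,Hx\rangle$, and $H\succ0$ means positive definite. $\mathrm{prox}^{\alpha}_{R}(\mathbf{Z})=\arg\min_{\mathbf{V}}\{R(\mathbf{V})+\frac{1}{2\alpha}\|\mathbf{V}-\mathbf{Z}\|^2\}$. *)

theory Defs
  imports "HOL-Analysis.Analysis"
begin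

definition ereal_epigraph :: "('a \<Rightarrow> ereal) \<Rightarrow> ('a \<times> real) set" where
  "ereal_epigraph r = {(x, t). r x \<le> ereal t}"

definition proper_fun :: "('a \<Rightarrow> ereal) \<Rightarrow> bool" where
  "proper_fun r \<longleftrightarrow> (\<forall>x. r x \<noteq> -\<infinity>) \<and> (\<exists>x. r x \<noteq> \<infinity>)"

definition closed_fun :: "('a::topological_space \<Rightarrow> ereal) \<Rightarrow> bool" where
  "closed_fun r \<longleftrightarrow> closed (ereal_epigraph r)"

definition convex_fun :: "('a::real_vector \<Rightarrow> ereal) \<Rightarrow> bool" where
  "convex_fun r \<longleftrightarrow> convex (ereal_epigraph r)"

definition gradient :: "('a::real_inner \<Rightarrow> real) \<Rightarrow> 'a \<Rightarrow> 'a" where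
  "gradient f x = (THE g. GDERIV f x :> g)"

(* Indicator of the set {0} in the sense of convex analysis. *)
definition delta0 :: "'a::zero \<Rightarrow> ereal" where
  "delta0 z = (if z = 0 then 0 else \<infinity>)"

definition self_adjoint :: "('a::real_inner \<Rightarrow> 'a) \<Rightarrow> bool" where
  "self_adjoint H \<longleftrightarrow> linear H \<and> (\<forall>x y. H x \<bullet> y = x \<bullet> H y)"

definition pos_def :: "('a::real_inner \<Rightarrow> 'a) \<Rightarrow> bool" where
  "pos_def H \<longleftrightarrow> self_adjoint H \<and> (\<forall>x. x \<noteq> 0 \<longrightarrow> 0 < x \<bullet> H x)"

(* The square of the norm induced by H; it may be negative when H is not positive semidefinite. *)
definition sqnorm_wrt :: "('a::real_inner \<Rightarrow> 'a) \<Rightarrow> 'a \<Rightarrow> real" where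
  "sqnorm_wrt H x = x \<bullet> H x"

(* A minimiser selected by Hilbert choice; it is unspecified when no minimiser exists. *)
definition prox :: "real \<Rightarrow> ('a::real_normed_vector \<Rightarrow> ereal) \<Rightarrow> 'a \<Rightarrow> 'a" where
  "prox \<alpha> R Z = arg_min (\<lambda>V. R V + ereal (1 / (2 * \<alpha>) * (norm (V - Z))\<^sup>2)) (\<lambda>V. True)"

definition objective ::
  "(real^'n \<Rightarrow> real) \<Rightarrow> (real^'p1 \<Rightarrow> ereal) \<Rightarrow> real^'n^'p1 \<Rightarrow> real^'n^'p2 \<Rightarrow> real^'p2
    \<Rightarrow> real^'n \<Rightarrow> ereal" where
  "objective f r B D d x = ereal (f x) + r (B *v x) + delta0 (D *v x - d)"

definition solution_set ::
  "(real^'n \<Rightarrow> real) \<Rightarrow> (real^'p1 \<Rightarrow> ereal) \<Rightarrow> real^'n^'p1 \<Rightarrow> real^'n^'p2 \<Rightarrow> real^'p2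
    \<Rightarrow> (real^'n) set" where
  "solution_set f r B D d = {x. is_arg_min (objective f r B D d) (\<lambda>x. True) x}"

(* The library norm on a product type is the Euclidean one, so the pair type models R^(n + p1). *)

definition lift_F :: "(real^'n \<Rightarrow> real) \<Rightarrow> (real^'n) \<times> (real^'p1) \<Rightarrow> real" where
  "lift_F f X = f (fst X)"

definition lift_R :: "(real^'p1 \<Rightarrow> ereal) \<Rightarrow> (real^'n) \<times> (real^'p1) \<Rightarrow> ereal" where
  "lift_R r X = r (snd X)"

definition lift_D ::
  "real^'n^'p1 \<Rightarrow> real^'n^'p2 \<Rightarrow> (real^'n) \<times> (real^'p1) \<Rightarrow> (real^'p2) \<times> (real^'p1)" where
  "lift_D B D X = (D *v fst X, B *v fst X - snd X)"

definition lift_d :: "real^'p2 \<Rightarrow> (real^'p2) \<times> (real^'p1)" where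
  "lift_d d = (d, 0)"

definition lagrangian ::
  "('x \<Rightarrow> real) \<Rightarrow> ('x \<Rightarrow> ereal) \<Rightarrow> ('x \<Rightarrow> 'y::real_inner) \<Rightarrow> 'y \<Rightarrow> 'x \<Rightarrow> 'y \<Rightarrow> ereal" where
  "lagrangian F R A b X \<Lambda> = ereal (F X) + R X + ereal (\<Lambda> \<bullet> (A X - b))"

definition saddle_points :: "('x \<Rightarrow> 'y \<Rightarrow> ereal) \<Rightarrow> ('x \<times> 'y) set" where
  "saddle_points \<L> =
     {(Xs, \<Lambda>s). \<forall>X \<Lambda>. \<L> Xs \<Lambda> \<le> \<L> Xs \<Lambda>s \<and> \<L> Xs \<Lambda>s \<le> \<L> X \<Lambda>s}"

end

(* Eliminating the optimality conditions of the two minimisation steps shows that, for every saddle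
   point (X', L'), the quantity |X^k - X'|^2 / alpha + |L^k - L'|_Q^2 decreases in each step by at
   least (1/alpha - L/2) |X^k - Xbar^k|^2 + |L^(k+1) - L^k|_J^2; the gradient term is absorbed by the
   Baillon-Haddad inequality. Hence the iterates are bounded and both residuals vanish, so by
   closedness of the subdifferential every cluster point is a saddle point. Taking that cluster
   point as the reference point, the monotone quantity has a subsequence tending to 0 and therefore
   tends to 0 itself. *)

theory Submission
  imports Defs
begin

text \<open>\<open>prox\<close> and the dual \<open>arg_min\<close> are Hilbert choices, so no
  optimality condition is available before a minimiser is known to exist. For the proximal step an
  affine minorant of \<open>R\<close> forces the objective to be coercive; it is read off from the
  subgradient at a saddle point, so strong duality supplies it without any separation argument. For
  the dual step, \<open>Q\<close> is \<open>J\<close> plus \<alpha> times the positive semidefinite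
  operator \<open>A (adjoint A y)\<close>, hence positive definite, and the minimiser is unique. The
  matrix \<open>J\<close> comes out of a cancellation. Let u be \<open>Xbar k\<close> minus the
  primal part of the saddle point and let D be the dual increment. The dual step says that Q D is
  the image of u under the constraint map. The cross term of the correction step is therefore -2 <D,
  Q D>; together with <D, Q D> from the dual square and \<alpha> |adjoint A D|^2 from the primal
  one, exactly -<D, J D> remains.\<close>

text \<open>Quantifying over points \<open>(V, t)\<close> of the epigraph keeps all arithmetic in the reals.\<close>

definition subgradient :: "('a::real_inner \<Rightarrow> ereal) \<Rightarrow> 'a \<Rightarrow> 'a \<Rightarrow> bool" where
  "subgradient R p \<xi> \<longleftrightarrow>
     (\<exists>\<rho>. R p = ereal \<rho> \<and> (\<forall>V t. R V \<le> ereal t \<longrightarrow> \<rho> + \<xi> \<bullet> (V - p) \<le> t))"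

section \<open>Directional derivatives and subgradients\<close>

lemma gderiv_along_line:
  assumes "GDERIV g (p + s *\<^sub>R h) :> \<gamma>"
  shows "((\<lambda>s. g (p + s *\<^sub>R h)) has_real_derivative \<gamma> \<bullet> h) (at s)"
proof -
  have 1: "(g has_derivative (\<lambda>v. v \<bullet> \<gamma>)) (at (p + s *\<^sub>R h))"
    using assms by (simp add: gderiv_def)
  have 2: "((\<lambda>s. p + s *\<^sub>R h) has_derivative (\<lambda>t. t *\<^sub>R h)) (at s)"
    by (auto intro!: derivative_eq_intros)
  have "((\<lambda>s. g (p + s *\<^sub>R h)) has_derivative (\<lambda>t. (t *\<^sub>R h) \<bullet> \<gamma>)) (at s)"
    using has_derivative_compose[OF 2 1] by simp
  then show ?thesis
    unfolding has_field_derivative_def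
    by (rule has_derivative_eq_rhs) (auto simp: inner_commute mult.commute)
qed

text \<open>The difference quotients from the right are bounded below by c, and so is their limit.
  This turns inequalities along a segment into first-order conditions.\<close>

lemma gderiv_directional_ge:
  assumes "GDERIV g p :> \<gamma>"
    and "\<And>s. 0 < s \<Longrightarrow> s < 1 \<Longrightarrow> g p + s * c \<le> g (p + s *\<^sub>R h)"
  shows "c \<le> \<gamma> \<bullet> h"
proof -
  have "((\<lambda>s. g (p + s *\<^sub>R h)) has_real_derivative \<gamma> \<bullet> h) (at 0)"
    using assms(1) by (intro gderiv_along_line) simp
  then have "((\<lambda>s. (g (p + s *\<^sub>R h) - g p) / s) \<longlongrightarrow> \<gamma> \<bullet> h) (at 0)"
    by (simp add: has_field_derivative_iff)
  then have lim: "((\<lambda>s. (g (p + s *\<^sub>R h) - g p) / s) \<longlongrightarrow> \<gamma> \<bullet> h) (at_right 0)"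
    by (rule filterlim_mono) (auto intro: at_le)
  have "eventually (\<lambda>s. s \<in> {0<..<1}) (at_right (0::real))"
    by (rule eventually_at_right_real) simp
  then have "eventually (\<lambda>s. c \<le> (g (p + s *\<^sub>R h) - g p) / s) (at_right 0)"
  proof (rule eventually_mono)
    fix s :: real assume s: "s \<in> {0<..<1}"
    then show "c \<le> (g (p + s *\<^sub>R h) - g p) / s"
      using assms(2)[of s] by (simp add: field_simps)
  qed
  then show ?thesis
    using lim by (intro tendsto_lowerbound) auto
qed

text \<open>Convexity bounds -F from below along the segment from x to y, with slope F x - F y, so
  the directional bound is applied to -F.\<close>

lemma convex_on_gderiv_le:
  assumes "convex_on UNIV F" and "GDERIV F x :> \<gamma>"
  shows "F x + \<gamma> \<bullet> (y - x) \<le> F y"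
proof -
  have "GDERIV (\<lambda>z. - F z) x :> - \<gamma>"
    using assms(2) by (rule GDERIV_minus)
  then have "F x - F y \<le> - \<gamma> \<bullet> (y - x)"
  proof (rule gderiv_directional_ge)
    fix s :: real assume s: "0 < s" "s < 1"
    have "F ((1 - s) *\<^sub>R x + s *\<^sub>R y) \<le> (1 - s) * F x + s * F y"
      using s by (intro convex_onD[OF assms(1)]) auto
    moreover have "(1 - s) *\<^sub>R x + s *\<^sub>R y = x + s *\<^sub>R (y - x)"
      by (simp add: algebra_simps)
    ultimately show "- F x + s * (F x - F y) \<le> - F (x + s *\<^sub>R (y - x))"
      by (simp add: algebra_simps)
  qed
  then show ?thesis by simp
qed

text \<open>Fermat's rule for a smooth term plus a convex one. The segment from (p, \<rho>) to an
  epigraph point (V, t) stays in the epigraph, so minimality bounds g from below along it with slope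
  \<rho> - t. It serves both the proximal objective and the Lagrangian.\<close>

lemma minimizer_imp_subgradient:
  assumes convex: "convex_fun R" and fin: "R p = ereal \<rho>"
    and deriv: "GDERIV g p :> \<gamma>"
    and min: "\<And>V t. R V \<le> ereal t \<Longrightarrow> g p + \<rho> \<le> g V + t"
  shows "subgradient R p (- \<gamma>)"
proof -
  have "\<rho> + (- \<gamma>) \<bullet> (V - p) \<le> t" if "R V \<le> ereal t" for V t
  proof -
    have "\<rho> - t \<le> \<gamma> \<bullet> (V - p)"
      using deriv
    proof (rule gderiv_directional_ge)
      fix s :: real assume s: "0 < s" "s < 1"
      have "(1 - s) *\<^sub>R (p, \<rho>) + s *\<^sub>R (V, t) \<in> ereal_epigraph R"
        using s that fin convex unfolding convex_fun_def
        by (intro convexD_alt) (auto simp: ereal_epigraph_def)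
      moreover have "(1 - s) *\<^sub>R p + s *\<^sub>R V = p + s *\<^sub>R (V - p)"
        by (simp add: algebra_simps)
      ultimately have "R (p + s *\<^sub>R (V - p)) \<le> ereal ((1 - s) * \<rho> + s * t)"
        by (simp add: ereal_epigraph_def)
      from min[OF this] show "g p + s * (\<rho> - t) \<le> g (p + s *\<^sub>R (V - p))"
        by (simp add: algebra_simps)
    qed
    then show ?thesis by simp
  qed
  then show ?thesis
    using fin unfolding subgradient_def by blast
qed

lemma subgradient_monotone:
  assumes "subgradient R p \<xi>" and "subgradient R q \<eta>"
  shows "0 \<le> (\<xi> - \<eta>) \<bullet> (p - q)"
proof -
  obtain \<rho> \<sigma> where "R p = ereal \<rho>" "R q = ereal \<sigma>"
    and "\<rho> + \<xi> \<bullet> (q - p) \<le> \<sigma>" "\<sigma> + \<eta> \<bullet> (p - q) \<le> \<rho>"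
    using assms unfolding subgradient_def by (metis order_refl)
  then show ?thesis
    by (simp add: inner_diff_left inner_diff_right)
qed

text \<open>Solved for the value at \<open>p k\<close>, the subgradient inequality places a point in
  the epigraph of R. These points converge, and closedness of the epigraph gives the inequality at
  the limit.\<close>

lemma subgradient_closed:
  assumes closed: "closed_fun R" and proper: "proper_fun R"
    and sub: "\<And>k. subgradient R (p k) (\<xi> k)"
    and lim: "p \<longlonglongrightarrow> p'" "\<xi> \<longlonglongrightarrow> \<xi>'"
  shows "subgradient R p' \<xi>'"
proof -
  have le: "R p' \<le> ereal (t - \<xi>' \<bullet> (V - p'))" if "R V \<le> ereal t" for V t
  proof -
    have mem: "(p k, t - \<xi> k \<bullet> (V - p k)) \<in> ereal_epigraph R" for k
    proof -
      obtain \<rho> where "R (p k) = ereal \<rho>" "\<And>V t. R V \<le> ereal t \<Longrightarrow> \<rho> + \<xi> k \<bullet> (V - p k) \<le> t"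
        using sub[of k] unfolding subgradient_def by blast
      from this(1) this(2)[OF that] show ?thesis by (simp add: ereal_epigraph_def)
    qed
    have "(\<lambda>k. (p k, t - \<xi> k \<bullet> (V - p k))) \<longlonglongrightarrow> (p', t - \<xi>' \<bullet> (V - p'))"
      by (intro tendsto_intros lim)
    with closed[unfolded closed_fun_def] mem have "(p', t - \<xi>' \<bullet> (V - p')) \<in> ereal_epigraph R"
      by (rule closed_sequentially)
    then show ?thesis by (simp add: ereal_epigraph_def)
  qed
  \<comment> \<open>Finiteness of R at the limit: the bound \<open>le\<close> at a point of finite
    value excludes \<infinity>, and properness excludes the other infinity.\<close>
  obtain V where "R V \<noteq> \<infinity>" "R V \<noteq> -\<infinity>" "R p' \<noteq> -\<infinity>"
    using proper unfolding proper_fun_def by blast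
  then obtain t where t: "R V = ereal t" by (cases "R V") auto
  obtain \<rho> where \<rho>: "R p' = ereal \<rho>"
    using le[of V t] t \<open>R p' \<noteq> -\<infinity>\<close> by (cases "R p'") auto
  have "\<rho> + \<xi>' \<bullet> (V - p') \<le> t" if "R V \<le> ereal t" for V t
    using le[OF that] \<rho> by simp
  then show ?thesis
    using \<rho> unfolding subgradient_def by blast
qed

section \<open>The proximal map: existence and optimality condition\<close>

text \<open>R is extended-valued and need not be continuous. Passing to the epigraph replaces it by
  the height t, so that a continuous function is minimised over a closed set and compactness of a
  sublevel set suffices.\<close>

lemma prox_exists:
  fixes R :: "'a::euclidean_space \<Rightarrow> ereal"
  assumes closed: "closed_fun R" and proper: "proper_fun R"
    and sub: "subgradient R p \<xi>" and \<alpha>: "0 < \<alpha>"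
  shows "\<exists>V. is_arg_min (\<lambda>V. R V + ereal (1 / (2 * \<alpha>) * (norm (V - Z))\<^sup>2)) (\<lambda>V. True) V"
proof -
  define q where "q V = 1 / (2 * \<alpha>) * (norm (V - Z))\<^sup>2" for V
  obtain \<rho> where \<rho>: "R p = ereal \<rho>"
    and lower: "\<And>V t. R V \<le> ereal t \<Longrightarrow> \<rho> + \<xi> \<bullet> (V - p) \<le> t"
    using sub unfolding subgradient_def by blast
  \<comment> \<open>\<open>S\<close> is bounded because \<open>R\<close> has the affine minorant given by \<open>\<xi>\<close>.\<close>
  define S where "S = ereal_epigraph R \<inter> {w. snd w + q (fst w) \<le> \<rho> + q p}"
  have q_nonneg: "0 \<le> q V" for V
    using \<alpha> by (simp add: q_def)
  have cont: "continuous_on S (\<lambda>w. snd w + q (fst w))"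
    unfolding q_def by (intro continuous_intros)
  have "closed {w::'a \<times> real. snd w + q (fst w) \<le> \<rho> + q p}"
    unfolding q_def by (intro closed_Collect_le continuous_intros)
  then have "closed S"
    using closed unfolding S_def closed_fun_def by blast
  moreover have "bounded S"
  proof -
    define a where "a = norm \<xi>"
    define c where "c = q p + norm \<xi> * norm (Z - p)"
    \<comment> \<open>Chosen to contradict the inequality \<open>quad\<close> below: for u \<ge> 1
      its right-hand side is at most (2 \<alpha> a + 2 \<alpha> c) u = (m - 1) u.\<close>
    define m where "m = 2 * \<alpha> * a + 2 * \<alpha> * c + 1"
    have ac: "0 \<le> a" "0 \<le> c" using q_nonneg by (auto simp: a_def c_def)
    have "fst w \<in> cball Z m \<and> snd w \<in> {\<rho> - a * (m + norm (Z - p)) .. \<rho> + q p}" if w: "w \<in> S" for w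
    proof -
      obtain V t where wV: "w = (V, t)" by (cases w)
      have V: "R V \<le> ereal t" "t + q V \<le> \<rho> + q p"
        using w by (auto simp: S_def ereal_epigraph_def wV)
      define u where "u = norm (V - Z)"
      have u: "0 \<le> u" by (simp add: u_def)
      have "\<bar>\<xi> \<bullet> (V - p)\<bar> \<le> norm \<xi> * norm (V - p)"
        by (rule Cauchy_Schwarz_ineq2)
      moreover have "norm (V - p) \<le> u + norm (Z - p)"
        unfolding u_def by (metis norm_diff_triangle_ineq diff_add_cancel norm_triangle_ineq add_diff_eq)
      then have "a * norm (V - p) \<le> a * (u + norm (Z - p))"
        using ac by (intro mult_left_mono)
      ultimately have t_low: "\<rho> - a * (u + norm (Z - p)) \<le> t"
        using lower[OF V(1)] by (simp add: a_def abs_le_iff)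
      then have "1 / (2 * \<alpha>) * u\<^sup>2 \<le> a * u + c"
        using V(2) by (simp add: q_def c_def a_def u_def algebra_simps)
      then have quad: "u\<^sup>2 \<le> 2 * \<alpha> * a * u + 2 * \<alpha> * c"
        using \<alpha> by (simp add: field_simps)
      have "u \<le> m"
      proof (rule ccontr)
        assume "\<not> u \<le> m"
        then have um: "m < u" by simp
        have m1: "1 \<le> m" using ac \<alpha> by (simp add: m_def)
        have "2 * \<alpha> * c * 1 \<le> 2 * \<alpha> * c * u"
          using ac \<alpha> um m1 by (intro mult_left_mono) auto
        then have "u\<^sup>2 \<le> (m - 1) * u"
          using quad by (simp add: m_def algebra_simps)
        also have "\<dots> < u * u"
          using um m1 by (intro mult_strict_right_mono) auto
        finally show False by (simp add: power2_eq_square)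
      qed
      moreover have "\<rho> - a * (m + norm (Z - p)) \<le> t"
      proof -
        have "a * (u + norm (Z - p)) \<le> a * (m + norm (Z - p))"
          using \<open>u \<le> m\<close> ac by (intro mult_left_mono) auto
        then show ?thesis using t_low by simp
      qed
      moreover have "t \<le> \<rho> + q p"
        using V(2) q_nonneg[of V] by simp
      ultimately show ?thesis
        by (simp add: wV u_def dist_norm norm_minus_commute)
    qed
    then have "S \<subseteq> cball Z m \<times> {\<rho> - a * (m + norm (Z - p)) .. \<rho> + q p}"
      by (auto simp: mem_Times_iff)
    moreover have "bounded (cball Z m \<times> {\<rho> - a * (m + norm (Z - p)) .. \<rho> + q p})"
      by (intro bounded_Times bounded_cball bounded_closed_interval)
    ultimately show ?thesis by (rule bounded_subset[rotated])
  qed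
  ultimately have "compact S"
    by (simp add: compact_eq_bounded_closed)
  moreover have "(p, \<rho>) \<in> S"
    using \<rho> by (simp add: S_def ereal_epigraph_def)
  ultimately obtain w where w: "w \<in> S"
    and w_min: "\<And>v. v \<in> S \<Longrightarrow> snd w + q (fst w) \<le> snd v + q (fst v)"
    using continuous_attains_inf[OF _ _ cont] by blast
  have "is_arg_min (\<lambda>V. R V + ereal (q V)) (\<lambda>V. True) (fst w)"
    unfolding is_arg_min_def
  proof (intro conjI notI; (elim exE conjE)?)
    fix V assume less: "R V + ereal (q V) < R (fst w) + ereal (q (fst w))"
    \<comment> \<open>The height of w may exceed the value of R below it; that only lowers the
      objective at \<open>fst w\<close>.\<close>
    have "R (fst w) + ereal (q (fst w)) \<le> ereal (snd w + q (fst w))"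
      using w by (cases "R (fst w)") (auto simp: S_def ereal_epigraph_def split: prod.splits)
    with less have less': "R V + ereal (q V) < ereal (snd w + q (fst w))"
      by simp
    moreover have "R V \<noteq> -\<infinity>" using proper by (simp add: proper_fun_def)
    ultimately obtain t where t: "R V = ereal t" "t + q V < snd w + q (fst w)"
      by (cases "R V") auto
    then have "(V, t) \<in> S"
      using w by (auto simp: S_def ereal_epigraph_def)
    from w_min[OF this] t show False by simp
  qed simp
  then show ?thesis unfolding q_def by blast
qed

lemma prox_subgradient:
  fixes R :: "'a::euclidean_space \<Rightarrow> ereal"
  assumes closed: "closed_fun R" and proper: "proper_fun R" and convex: "convex_fun R"
    and sub: "subgradient R p \<xi>" and \<alpha>: "0 < \<alpha>"
  shows "subgradient R (prox \<alpha> R Z) ((1 / \<alpha>) *\<^sub>R (Z - prox \<alpha> R Z))"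
proof -
  define q where "q V = 1 / (2 * \<alpha>) * (norm (V - Z))\<^sup>2" for V
  define P where "P = prox \<alpha> R Z"
  \<comment> \<open>Existence is what makes the Hilbert choice in \<open>prox\<close> a genuine
    minimiser.\<close>
  have "is_arg_min (\<lambda>V. R V + ereal (q V)) (\<lambda>V. True) P"
    unfolding P_def prox_def arg_min_def q_def
    using prox_exists[OF closed proper sub \<alpha>] by (rule someI_ex)
  then have min: "R P + ereal (q P) \<le> R V + ereal (q V)" for V
    by (auto simp: is_arg_min_def not_less)
  obtain \<sigma> where "R p = ereal \<sigma>"
    using sub unfolding subgradient_def by blast
  then obtain \<rho> where \<rho>: "R P = ereal \<rho>"
    using min[of p] proper by (cases "R P") (auto simp: proper_fun_def)
  have q_eq: "q = (\<lambda>V. 1 / (2 * \<alpha>) * ((V - Z) \<bullet> (V - Z)))"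
    by (simp add: q_def fun_eq_iff power2_norm_eq_inner)
  have "subgradient R P (- ((1 / \<alpha>) *\<^sub>R (P - Z)))"
  proof (rule minimizer_imp_subgradient[OF convex \<rho>])
    show "GDERIV q P :> (1 / \<alpha>) *\<^sub>R (P - Z)"
      unfolding q_eq gderiv_def
      by (rule derivative_eq_intros refl)+ (simp add: fun_eq_iff inner_commute)
    show "q P + \<rho> \<le> q V + t" if "R V \<le> ereal t" for V t
    proof -
      have "ereal (\<rho> + q P) \<le> R V + ereal (q V)"
        using min[of V] \<rho> by simp
      also have "\<dots> \<le> ereal (t + q V)"
        using that by (cases "R V") auto
      finally show ?thesis by simp
    qed
  qed
  moreover have "- ((1 / \<alpha>) *\<^sub>R (P - Z)) = (1 / \<alpha>) *\<^sub>R (Z - P)"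
    by (simp add: scaleR_diff_right)
  ultimately show ?thesis by (simp add: P_def)
qed

section \<open>Convex functions with Lipschitz gradient\<close>

text \<open>Along the segment, F minus its quadratic upper model has nonpositive derivative by
  Cauchy-Schwarz and the Lipschitz bound; comparing the endpoints replaces an integral.\<close>

lemma descent_lemma:
  fixes F :: "'a::real_inner \<Rightarrow> real"
  assumes deriv: "\<And>x. GDERIV F x :> G x" and lip: "L-lipschitz_on UNIV G"
  shows "F y \<le> F x + G x \<bullet> (y - x) + L / 2 * (norm (y - x))\<^sup>2"
proof -
  define h where "h = y - x"
  define \<psi> where "\<psi> s = F (x + s *\<^sub>R h) - s * (G x \<bullet> h) - L / 2 * (norm h)\<^sup>2 * s\<^sup>2" for s
  have "\<psi> 1 \<le> \<psi> 0"
  proof (rule DERIV_nonpos_imp_nonincreasing[where f = \<psi>])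
    fix s :: real assume s: "0 \<le> s" "s \<le> 1"
    define D where "D = G (x + s *\<^sub>R h) \<bullet> h - G x \<bullet> h - L * (norm h)\<^sup>2 * s"
    have "(\<psi> has_real_derivative D) (at s)"
      unfolding \<psi>_def D_def
      by (rule derivative_eq_intros gderiv_along_line deriv refl)+ simp
    moreover have "D \<le> 0"
    proof -
      have "G (x + s *\<^sub>R h) \<bullet> h - G x \<bullet> h = (G (x + s *\<^sub>R h) - G x) \<bullet> h"
        by (simp add: inner_diff_left)
      also have "\<dots> \<le> norm (G (x + s *\<^sub>R h) - G x) * norm h"
        by (rule norm_cauchy_schwarz)
      also have "\<dots> \<le> (L * norm (s *\<^sub>R h)) * norm h"
        using lipschitz_onD[OF lip, of "x + s *\<^sub>R h" x]
        by (intro mult_right_mono) (auto simp: dist_norm)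
      finally show ?thesis
        using s by (simp add: D_def power2_eq_square mult.assoc mult.commute mult.left_commute)
    qed
    ultimately show "\<exists>D. (\<psi> has_real_derivative D) (at s) \<and> D \<le> 0" by blast
  qed simp
  then show ?thesis
    by (simp add: \<psi>_def h_def)
qed

text \<open>\<open>half\<close> sharpens the gradient inequality by |G y - G x|^2 / (2 L). Adding
  its copy with x and y exchanged cancels the function values and doubles that surplus. The step
  length 1 / L minimises the quadratic upper model of F z - G x \<bullet> z around y.\<close>

lemma Baillon_Haddad:
  fixes F :: "'a::real_inner \<Rightarrow> real"
  assumes convex: "convex_on UNIV F" and deriv: "\<And>x. GDERIV F x :> G x"
    and lip: "L-lipschitz_on UNIV G" and L: "0 < L"
  shows "(norm (G x - G y))\<^sup>2 \<le> L * ((G x - G y) \<bullet> (x - y))"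
proof -
  \<comment> \<open>Compare \<open>x\<close>, the minimiser of \<open>F z - G x \<bullet> z\<close>, with a gradient step from \<open>y\<close>.\<close>
  have half: "F x + G x \<bullet> (y - x) + (norm (G y - G x))\<^sup>2 / (2 * L) \<le> F y" for x y
  proof -
    define g where "g = G y - G x"
    define z where "z = y - (1 / L) *\<^sub>R g"
    have "F x + G x \<bullet> (z - x) \<le> F z"
      by (rule convex_on_gderiv_le[OF convex deriv])
    also have "F z \<le> F y + G y \<bullet> (z - y) + L / 2 * (norm (z - y))\<^sup>2"
      by (rule descent_lemma[OF deriv lip])
    finally have "F x + G x \<bullet> (y - x) - G x \<bullet> g / L
        \<le> F y - G y \<bullet> g / L + L / 2 * ((norm g)\<^sup>2 / L\<^sup>2)"
      by (simp add: z_def inner_diff_right power_divide)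
    moreover have "L / 2 * ((norm g)\<^sup>2 / L\<^sup>2) = (norm g)\<^sup>2 / (2 * L)"
      using L by (simp add: power2_eq_square)
    moreover have "G y \<bullet> g / L - G x \<bullet> g / L = 2 * ((norm g)\<^sup>2 / (2 * L))"
      using L by (simp add: g_def power2_norm_eq_inner inner_diff_left diff_divide_distrib)
    ultimately show ?thesis by (simp add: g_def)
  qed
  have "(norm (G x - G y))\<^sup>2 / L \<le> (G x - G y) \<bullet> (x - y)"
    using half[of x y] half[of y x]
    by (simp add: norm_minus_commute inner_diff_left inner_diff_right)
  then show ?thesis using L by (simp add: field_simps)
qed

section \<open>Positive definite operators\<close>

text \<open>The constant is the minimum of the quadratic form on the compact unit sphere;
  homogeneity extends the bound to all vectors.\<close>

lemma pos_def_imp_coercive: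
  fixes H :: "'a::euclidean_space \<Rightarrow> 'a"
  assumes "pos_def H"
  shows "\<exists>c>0. \<forall>x. c * (norm x)\<^sup>2 \<le> x \<bullet> H x"
proof -
  have lin: "linear H" and pos: "\<And>x. x \<noteq> 0 \<Longrightarrow> 0 < x \<bullet> H x"
    using assms by (auto simp: pos_def_def self_adjoint_def)
  obtain e :: 'a where "e \<in> Basis" using nonempty_Basis by blast
  then have "sphere 0 1 \<noteq> ({} :: 'a set)" by (auto intro!: exI[of _ e] simp: norm_Basis)
  moreover have "continuous_on (sphere 0 1) (\<lambda>x. x \<bullet> H x)"
    using lin by (intro continuous_intros linear_continuous_on) (simp add: linear_conv_bounded_linear)
  ultimately obtain m where m: "m \<in> sphere 0 1"
    and min: "\<And>x. x \<in> sphere 0 1 \<Longrightarrow> m \<bullet> H m \<le> x \<bullet> H x"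
    using continuous_attains_inf[of "sphere 0 1" "\<lambda>x. x \<bullet> H x"] by auto
  have "(m \<bullet> H m) * (norm x)\<^sup>2 \<le> x \<bullet> H x" for x
  proof (cases "x = 0")
    case False
    define u where "u = (1 / norm x) *\<^sub>R x"
    have x: "x = norm x *\<^sub>R u" using False by (simp add: u_def)
    have "u \<in> sphere 0 1" using False by (simp add: u_def)
    then have "m \<bullet> H m \<le> u \<bullet> H u" by (rule min)
    moreover have "x \<bullet> H x = (norm x)\<^sup>2 * (u \<bullet> H u)"
      by (subst (1 2) x) (simp add: linear_scale[OF lin] power2_eq_square)
    ultimately show ?thesis by (simp add: mult.commute[of "m \<bullet> H m"] mult_left_mono)
  qed (simp add: linear_0[OF lin])
  moreover have "0 < m \<bullet> H m" using m by (intro pos) auto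
  ultimately show ?thesis by blast
qed

text \<open>Completing the square at m = a + z with H z = -c shows that m is the only minimiser, so
  the choice made by \<open>arg_min\<close> must be m. Such a z exists because an injective linear
  map is surjective in finite dimension.\<close>

lemma arg_min_pos_def_quadratic:
  fixes H :: "'a::euclidean_space \<Rightarrow> 'a"
  assumes "pos_def H"
  shows "H (arg_min (\<lambda>y. 1 / 2 * sqnorm_wrt H (y - a) + y \<bullet> c) (\<lambda>y. True) - a) = - c"
proof -
  have lin: "linear H" and sym: "\<And>x y. H x \<bullet> y = x \<bullet> H y"
    and pos: "\<And>x. x \<noteq> 0 \<Longrightarrow> 0 < x \<bullet> H x"
    using assms by (auto simp: pos_def_def self_adjoint_def)
  define \<phi> where "\<phi> y = 1 / 2 * sqnorm_wrt H (y - a) + y \<bullet> c" for y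
  have "inj H"
    unfolding linear_injective_0[OF lin] using pos by (metis inner_zero_right less_irrefl)
  then have "surj H" using linear_injective_imp_surjective[OF lin] by blast
  then obtain z where z: "H z = - c" by (metis surjD)
  define m where "m = a + z"
  have \<phi>: "\<phi> y = \<phi> m + 1 / 2 * ((y - m) \<bullet> H (y - m))" for y
  proof -
    have ya: "y - a = (y - m) + z" and ma: "m - a = z" by (simp_all add: m_def)
    have "H (y - a) = H (y - m) - c"
      by (simp add: ya linear_add[OF lin] z)
    then have "\<phi> y = 1 / 2 * ((y - m) \<bullet> H (y - m) - (y - m) \<bullet> c + z \<bullet> H (y - m) - z \<bullet> c) + y \<bullet> c"
      unfolding \<phi>_def sqnorm_wrt_def by (simp add: ya inner_add_left inner_diff_right)
    moreover have "z \<bullet> H (y - m) = - ((y - m) \<bullet> c)"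
      by (metis sym z inner_commute inner_minus_right)
    moreover have "\<phi> m = - 1 / 2 * (z \<bullet> c) + m \<bullet> c"
      by (simp add: \<phi>_def sqnorm_wrt_def ma z)
    ultimately show ?thesis
      by (simp add: inner_diff_left algebra_simps)
  qed
  have strict: "\<phi> m < \<phi> y" if "y \<noteq> m" for y
    using pos[of "y - m"] that \<phi>[of y] by simp
  have "is_arg_min \<phi> (\<lambda>y. True) m"
    unfolding is_arg_min_def using strict by (metis less_asym)
  then have "is_arg_min \<phi> (\<lambda>y. True) (arg_min \<phi> (\<lambda>y. True))"
    unfolding arg_min_def by (rule someI)
  then have "arg_min \<phi> (\<lambda>y. True) = m"
    using strict unfolding is_arg_min_def by blast
  then show ?thesis using z by (simp add: \<phi>_def[abs_def] m_def)
qed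

section \<open>Gradients of differentiable functions\<close>

lemma gradient_eqI:
  assumes "GDERIV f x :> g"
  shows "gradient f x = g"
  unfolding gradient_def
proof (rule the_equality, rule assms)
  fix g' assume "GDERIV f x :> g'"
  then have "(\<lambda>h. h \<bullet> g') = (\<lambda>h. h \<bullet> g)"
    using assms unfolding gderiv_def by (rule has_derivative_unique)
  then show "g' = g"
    by (metis vector_eq_ldot)
qed

text \<open>The Riesz vector of the derivative is its adjoint applied to the real number 1.\<close>

lemma gderiv_gradient:
  fixes f :: "'a::euclidean_space \<Rightarrow> real"
  assumes "f differentiable (at x)"
  shows "GDERIV f x :> gradient f x"
proof -
  obtain f' where f': "(f has_derivative f') (at x)"
    using assms by (auto simp: differentiable_def)
  have lin: "linear f'" using f' by (rule has_derivative_linear)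
  have "f' = (\<lambda>h. h \<bullet> adjoint f' 1)"
    using adjoint_works[OF lin, of _ 1] by (simp add: fun_eq_iff)
  then have ex: "GDERIV f x :> adjoint f' 1"
    using f' by (simp add: gderiv_def)
  then show ?thesis by (simp add: gradient_eqI)
qed

section \<open>Saddle points as Karush-Kuhn-Tucker pairs\<close>

text \<open>Maximality in the multiplier is feasibility, and minimality in the primal variable is
  Fermat's rule. Conversely, the subgradient inequality for R and the gradient inequality for F add
  up to primal minimality.\<close>

lemma saddle_points_lagrangian_iff:
  fixes F :: "'a::euclidean_space \<Rightarrow> real" and A :: "'a \<Rightarrow> 'b::euclidean_space"
  assumes F_convex: "convex_on UNIV F" and deriv: "GDERIV F p :> \<gamma>"
    and proper: "proper_fun R" and R_convex: "convex_fun R" and lin: "linear A"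
  shows "(p, l) \<in> saddle_points (lagrangian F R A b)
     \<longleftrightarrow> A p = b \<and> subgradient R p (- (adjoint A l + \<gamma>))"
proof
  assume "(p, l) \<in> saddle_points (lagrangian F R A b)"
  then have max: "lagrangian F R A b p m \<le> lagrangian F R A b p l"
    and min: "lagrangian F R A b p l \<le> lagrangian F R A b V l" for V m
    by (auto simp: saddle_points_def)
  \<comment> \<open>Comparison with a point of finite value rules out R p = \<infinity>, where the
    condition on the multiplier would carry no information.\<close>
  obtain V where "R V \<noteq> \<infinity>" "R V \<noteq> -\<infinity>" "R p \<noteq> -\<infinity>"
    using proper unfolding proper_fun_def by blast
  then obtain \<rho> where \<rho>: "R p = ereal \<rho>"
    using min[of V] by (cases "R p"; cases "R V") (auto simp: lagrangian_def)
  \<comment> \<open>Moving the multiplier along the constraint residual leaves |A p - b|^2 \<le>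
    0.\<close>
  have "(l + (A p - b)) \<bullet> (A p - b) \<le> l \<bullet> (A p - b)"
    using max[of "l + (A p - b)"] \<rho> by (simp add: lagrangian_def)
  then have "A p = b"
    by (simp add: inner_add_left) (metis inner_gt_zero_iff not_less right_minus_eq)
  moreover have "subgradient R p (- (adjoint A l + \<gamma>))"
  proof (rule minimizer_imp_subgradient[OF R_convex \<rho>])
    have "((\<lambda>V. F V + l \<bullet> (A V - b)) has_derivative (\<lambda>h. h \<bullet> \<gamma> + l \<bullet> A h)) (at p)"
      using deriv lin unfolding gderiv_def
      by (auto intro!: derivative_eq_intros linear_imp_has_derivative)
    then show "GDERIV (\<lambda>V. F V + l \<bullet> (A V - b)) p :> adjoint A l + \<gamma>"
      unfolding gderiv_def
      by (rule has_derivative_eq_rhs)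
        (simp add: fun_eq_iff inner_add_right adjoint_works[OF lin] inner_commute)
    show "F p + l \<bullet> (A p - b) + \<rho> \<le> F V + l \<bullet> (A V - b) + t" if "R V \<le> ereal t" for V t
      using min[of V] that \<rho> by (cases "R V") (auto simp: lagrangian_def)
  qed
  ultimately show "A p = b \<and> subgradient R p (- (adjoint A l + \<gamma>))" by blast
next
  assume "A p = b \<and> subgradient R p (- (adjoint A l + \<gamma>))"
  then obtain \<rho> where Ap: "A p = b" and \<rho>: "R p = ereal \<rho>"
    and sub: "\<And>V t. R V \<le> ereal t \<Longrightarrow> \<rho> + (- (adjoint A l + \<gamma>)) \<bullet> (V - p) \<le> t"
    unfolding subgradient_def by blast
  have "lagrangian F R A b p l \<le> lagrangian F R A b V l" for V
  proof (cases "R V")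
    case (real t)
    have "\<rho> + (- (adjoint A l + \<gamma>)) \<bullet> (V - p) \<le> t"
      using real by (intro sub) simp
    moreover have "adjoint A l \<bullet> (V - p) = l \<bullet> (A V - b)"
      using adjoint_works[OF lin, of "V - p" l] by (simp add: inner_commute linear_diff[OF lin] Ap)
    moreover have "F p + \<gamma> \<bullet> (V - p) \<le> F V"
      by (rule convex_on_gderiv_le[OF F_convex deriv])
    ultimately show ?thesis
      using real \<rho> by (simp add: lagrangian_def Ap inner_add_left inner_minus_left del: minus_add_distrib)
  next
    case MInf
    then show ?thesis using proper by (simp add: proper_fun_def)
  qed (simp add: lagrangian_def)
  then show "(p, l) \<in> saddle_points (lagrangian F R A b)"
    by (simp add: saddle_points_def lagrangian_def Ap)
qed

section \<open>The iteration in abstract Euclidean spaces\<close>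

locale primal_dual_iteration =
  fixes F :: "'a::euclidean_space \<Rightarrow> real" and R :: "'a \<Rightarrow> ereal"
    and A :: "'a \<Rightarrow> 'b::euclidean_space" and b :: 'b and Q :: "'b \<Rightarrow> 'b"
    and G :: "'a \<Rightarrow> 'a" and L \<alpha> :: real
    and X Xbar :: "nat \<Rightarrow> 'a" and \<Lambda> :: "nat \<Rightarrow> 'b"
  assumes F_convex: "convex_on UNIV F"
    and F_deriv: "\<And>x. GDERIV F x :> G x"
    and G_lipschitz: "L-lipschitz_on UNIV G"
    and L_pos: "0 < L"
    and R_proper: "proper_fun R"
    and R_closed: "closed_fun R"
    and R_convex: "convex_fun R"
    and A_linear: "linear A"
    and Q_self_adjoint: "self_adjoint Q"
    and \<alpha>: "0 < \<alpha>" "\<alpha> < 2 / L"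
    and J_pos_def: "pos_def (\<lambda>y. Q y - \<alpha> *\<^sub>R A (adjoint A y))"
    and saddle_ex: "saddle_points (lagrangian F R A b) \<noteq> {}"
    and Xbar_step: "\<And>k. Xbar k = prox \<alpha> R (X k - \<alpha> *\<^sub>R (adjoint A (\<Lambda> k) + G (X k)))"
    and \<Lambda>_step: "\<And>k. \<Lambda> (Suc k) =
          arg_min (\<lambda>y. 1 / 2 * sqnorm_wrt Q (y - \<Lambda> k) + y \<bullet> (b - A (Xbar k))) (\<lambda>y. True)"
    and X_step: "\<And>k. X (Suc k) = Xbar k + \<alpha> *\<^sub>R adjoint A (\<Lambda> k - \<Lambda> (Suc k))"
begin

abbreviation saddles :: "('a \<times> 'b) set" where
  "saddles \<equiv> saddle_points (lagrangian F R A b)"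

abbreviation J :: "'b \<Rightarrow> 'b" where
  "J y \<equiv> Q y - \<alpha> *\<^sub>R A (adjoint A y)"

definition lyapunov :: "'a \<times> 'b \<Rightarrow> nat \<Rightarrow> real" where
  "lyapunov w k = (norm (X k - fst w))\<^sup>2 / \<alpha> + (\<Lambda> k - snd w) \<bullet> Q (\<Lambda> k - snd w)"

lemma Q_linear: "linear Q"
  using Q_self_adjoint by (simp add: self_adjoint_def)

lemma Q_sym: "Q x \<bullet> y = x \<bullet> Q y"
  using Q_self_adjoint by (simp add: self_adjoint_def)

lemma adjoint_A: "adjoint A y \<bullet> x = y \<bullet> A x"
  using adjoint_works[OF A_linear, of x y] by (simp add: inner_commute)

lemma J_quadratic: "y \<bullet> J y = y \<bullet> Q y - \<alpha> * (norm (adjoint A y))\<^sup>2"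
  by (simp add: inner_diff_right power2_norm_eq_inner adjoint_A)

text \<open>Q exceeds J by a positive semidefinite operator.\<close>

lemma Q_pos_def: "pos_def Q"
  unfolding pos_def_def
proof (intro conjI allI impI Q_self_adjoint)
  fix y :: 'b assume "y \<noteq> 0"
  then have "0 < y \<bullet> J y"
    using J_pos_def by (simp add: pos_def_def)
  then show "0 < y \<bullet> Q y"
    using J_quadratic[of y] \<alpha> by (smt (verit) mult_nonneg_nonneg zero_le_power2)
qed

text \<open>Stationarity of the dual step. Vanishing dual increments thus make \<open>Xbar\<close>
  asymptotically feasible.\<close>

lemma Q_increment: "Q (\<Lambda> (Suc k) - \<Lambda> k) = A (Xbar k) - b"
  using arg_min_pos_def_quadratic[OF Q_pos_def, of "\<Lambda> k" "b - A (Xbar k)"]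
  by (simp add: \<Lambda>_step)

lemma saddle_iff:
  "(p, l) \<in> saddles \<longleftrightarrow> A p = b \<and> subgradient R p (- (adjoint A l + G p))"
  by (rule saddle_points_lagrangian_iff[OF F_convex F_deriv R_proper R_convex A_linear])

text \<open>Optimality of the proximal step; any saddle point furnishes the reference subgradient
  that makes the minimiser exist.\<close>

lemma Xbar_subgradient:
  "subgradient R (Xbar k) ((1 / \<alpha>) *\<^sub>R (X k - Xbar k) - adjoint A (\<Lambda> k) - G (X k))"
proof -
  obtain p l where "(p, l) \<in> saddles"
    using saddle_ex by auto
  then have "subgradient R p (- (adjoint A l + G p))"
    by (simp add: saddle_iff)
  from prox_subgradient[OF R_closed R_proper R_convex this \<alpha>(1),
      of "X k - \<alpha> *\<^sub>R (adjoint A (\<Lambda> k) + G (X k))"]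
  show ?thesis
    unfolding Xbar_step[symmetric] using \<alpha> by (simp add: algebra_simps)
qed

text \<open>Twice the inequality \<open>mono\<close> balances the cross terms v \<bullet> Q \<Delta>
  and e \<bullet> u / \<alpha> that arise from expanding the squares at steps k and k + 1. What
  remains is the J-form of the dual increment, |e|^2 / \<alpha>, and the gradient term bounded in
  \<open>grad\<close>.\<close>

lemma lyapunov_decrease:
  assumes "w \<in> saddles"
  shows "lyapunov w (Suc k) + (1 / \<alpha> - L / 2) * (norm (X k - Xbar k))\<^sup>2
      + (\<Lambda> (Suc k) - \<Lambda> k) \<bullet> J (\<Lambda> (Suc k) - \<Lambda> k) \<le> lyapunov w k"
proof -
  obtain p l where w: "w = (p, l)" by (cases w)
  have Ap: "A p = b" and sub: "subgradient R p (- (adjoint A l + G p))"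
    using assms by (simp_all add: w saddle_iff)
  define \<Delta> where "\<Delta> = \<Lambda> (Suc k) - \<Lambda> k"
  define e where "e = X k - Xbar k"
  define u where "u = Xbar k - p"
  define v where "v = \<Lambda> k - l"
  define g where "g = G (X k) - G p"
  have Q\<Delta>: "Q \<Delta> = A u"
    using Q_increment[of k] by (simp add: \<Delta>_def u_def linear_diff[OF A_linear] Ap)
  have "(1 / \<alpha>) *\<^sub>R (X k - Xbar k) - adjoint A (\<Lambda> k) - G (X k) - - (adjoint A l + G p)
      = (1 / \<alpha>) *\<^sub>R e - adjoint A v - g"
    by (simp add: e_def v_def g_def linear_diff[OF adjoint_linear[OF A_linear]])
  then have "0 \<le> ((1 / \<alpha>) *\<^sub>R e - adjoint A v - g) \<bullet> u"
    using subgradient_monotone[OF Xbar_subgradient sub, of k] by (simp add: u_def)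
  then have mono: "v \<bullet> Q \<Delta> + g \<bullet> u \<le> (e \<bullet> u) / \<alpha>"
    by (simp add: inner_diff_left adjoint_A Q\<Delta>)
  have coco: "(norm g)\<^sup>2 \<le> L * (g \<bullet> (e + u))"
    using Baillon_Haddad[OF F_convex F_deriv G_lipschitz L_pos, of "X k" p]
    by (simp add: g_def e_def u_def)
  \<comment> \<open>The weights are such that cocoercivity absorbs the |g|^2 term completely and
    only L / 2 |e|^2 is lost; this allows every \<alpha> below 2 / L.\<close>
  have young: "2 * (g \<bullet> e) \<le> 2 / L * (norm g)\<^sup>2 + L / 2 * (norm e)\<^sup>2"
  proof -
    have "0 \<le> (norm (g - (L / 2) *\<^sub>R e))\<^sup>2 * (2 / L)"
      using L_pos by simp
    also have "\<dots> = 2 / L * (norm g)\<^sup>2 - 2 * (g \<bullet> e) + L / 2 * (norm e)\<^sup>2"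
      using L_pos unfolding power2_norm_eq_inner
      by (simp add: inner_diff_left inner_diff_right inner_commute field_simps)
    finally show ?thesis by simp
  qed
  have "2 / L * (norm g)\<^sup>2 \<le> 2 * (g \<bullet> (e + u))"
    using coco L_pos by (simp add: field_simps)
  then have grad: "- 2 * (g \<bullet> u) \<le> L / 2 * (norm e)\<^sup>2"
    using young by (simp add: inner_add_right)
  have X': "X (Suc k) - p = u - \<alpha> *\<^sub>R adjoint A \<Delta>"
    unfolding X_step \<Delta>_def u_def by (simp add: linear_diff[OF adjoint_linear[OF A_linear]] algebra_simps)
  have "(norm (X (Suc k) - p))\<^sup>2 / \<alpha> = (norm u)\<^sup>2 / \<alpha> - 2 * (\<Delta> \<bullet> Q \<Delta>) + \<alpha> * (norm (adjoint A \<Delta>))\<^sup>2"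
  proof -
    have "(norm (X (Suc k) - p))\<^sup>2
        = (norm u)\<^sup>2 - 2 * \<alpha> * (adjoint A \<Delta> \<bullet> u) + \<alpha>\<^sup>2 * (norm (adjoint A \<Delta>))\<^sup>2"
      unfolding X' power2_norm_eq_inner
      by (simp add: inner_diff_left inner_diff_right inner_commute power2_eq_square algebra_simps)
    then show ?thesis
      using \<alpha> by (simp add: adjoint_A Q\<Delta> power2_eq_square field_simps)
  qed
  moreover have "(norm (X k - p))\<^sup>2 / \<alpha> = (norm e)\<^sup>2 / \<alpha> + 2 * (e \<bullet> u / \<alpha>) + (norm u)\<^sup>2 / \<alpha>"
  proof -
    have "X k - p = e + u" by (simp add: e_def u_def)
    then have "(norm (X k - p))\<^sup>2 = (norm e)\<^sup>2 + 2 * (e \<bullet> u) + (norm u)\<^sup>2"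
      unfolding power2_norm_eq_inner
      by (simp add: inner_add_left inner_add_right inner_commute)
    then show ?thesis by (simp add: add_divide_distrib)
  qed
  moreover have "(\<Lambda> (Suc k) - l) \<bullet> Q (\<Lambda> (Suc k) - l) = v \<bullet> Q v + 2 * (v \<bullet> Q \<Delta>) + \<Delta> \<bullet> Q \<Delta>"
  proof -
    have "\<Lambda> (Suc k) - l = v + \<Delta>" by (simp add: v_def \<Delta>_def)
    moreover have "\<Delta> \<bullet> Q v = v \<bullet> Q \<Delta>" using Q_sym[of \<Delta> v] by (simp add: inner_commute)
    ultimately show ?thesis
      by (simp add: linear_add[OF Q_linear] inner_add_left inner_add_right)
  qed
  moreover have "(1 / \<alpha> - L / 2) * (norm e)\<^sup>2 = (norm e)\<^sup>2 / \<alpha> - L / 2 * (norm e)\<^sup>2"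
    by (simp add: left_diff_distrib)
  ultimately show ?thesis
    using mono grad unfolding J_quadratic lyapunov_def w
    unfolding \<Delta>_def[symmetric] e_def[symmetric] by (simp add: v_def)
qed

lemma e_coeff_pos: "0 < 1 / \<alpha> - L / 2"
  using \<alpha> L_pos by (simp add: field_simps)

lemma J_nonneg: "0 \<le> y \<bullet> J y"
proof (cases "y = 0")
  case False
  then have "0 < y \<bullet> J y" using J_pos_def by (simp add: pos_def_def)
  then show ?thesis by simp
qed simp

lemma Q_nonneg: "0 \<le> y \<bullet> Q y"
  using Q_pos_def by (cases "y = 0") (auto simp: pos_def_def less_imp_le)

lemma lyapunov_nonneg: "0 \<le> lyapunov w k"
  using Q_nonneg \<alpha> by (simp add: lyapunov_def)

lemma lyapunov_decseq:
  assumes "w \<in> saddles"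
  shows "decseq (lyapunov w)"
proof (rule decseq_SucI)
  fix k
  have "0 \<le> (1 / \<alpha> - L / 2) * (norm (X k - Xbar k))\<^sup>2"
    using e_coeff_pos by simp
  then show "lyapunov w (Suc k) \<le> lyapunov w k"
    using lyapunov_decrease[OF assms, of k] J_nonneg[of "\<Lambda> (Suc k) - \<Lambda> k"] by linarith
qed

text \<open>The constant is uniform in w and k, so the same estimate yields boundedness and, at the
  end, norm convergence.\<close>

lemma lyapunov_coercive:
  "\<exists>c>0. \<forall>w k. c * (norm ((X k, \<Lambda> k) - w))\<^sup>2 \<le> lyapunov w k"
proof -
  obtain q where q: "0 < q" "\<And>y. q * (norm y)\<^sup>2 \<le> y \<bullet> Q y"
    using pos_def_imp_coercive[OF Q_pos_def] by blast
  define c where "c = min (1 / \<alpha>) q"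
  have c: "0 < c" using q \<alpha> by (simp add: c_def)
  have "c * (norm ((X k, \<Lambda> k) - w))\<^sup>2 \<le> lyapunov w k" for w k
  proof -
    obtain p l where w: "w = (p, l)" by (cases w)
    have "(norm ((X k, \<Lambda> k) - w))\<^sup>2 = (norm (X k - p))\<^sup>2 + (norm (\<Lambda> k - l))\<^sup>2"
      by (simp add: w norm_Pair)
    moreover have "c * (norm (X k - p))\<^sup>2 \<le> 1 / \<alpha> * (norm (X k - p))\<^sup>2"
      by (intro mult_right_mono) (auto simp: c_def)
    moreover have "c * (norm (\<Lambda> k - l))\<^sup>2 \<le> q * (norm (\<Lambda> k - l))\<^sup>2"
      by (intro mult_right_mono) (auto simp: c_def)
    ultimately show ?thesis
      using q(2)[of "\<Lambda> k - l"] by (simp add: lyapunov_def w distrib_left)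
  qed
  with c show ?thesis by blast
qed

lemma distance_bounded:
  assumes "w \<in> saddles"
  shows "bounded (range (\<lambda>k. norm ((X k, \<Lambda> k) - w)))"
proof -
  obtain c where c: "0 < c" "\<And>w k. c * (norm ((X k, \<Lambda> k) - w))\<^sup>2 \<le> lyapunov w k"
    using lyapunov_coercive by blast
  have "norm ((X k, \<Lambda> k) - w) \<le> sqrt (lyapunov w 0 / c)" for k
  proof (rule real_le_rsqrt)
    have "c * (norm ((X k, \<Lambda> k) - w))\<^sup>2 \<le> lyapunov w 0"
      using c(2)[where k = k] decseqD[OF lyapunov_decseq[OF assms] le0] by (rule order_trans)
    then show "(norm ((X k, \<Lambda> k) - w))\<^sup>2 \<le> lyapunov w 0 / c"
      using c(1) by (simp add: field_simps)
  qed
  then show ?thesis by (intro boundedI[where B = "sqrt (lyapunov w 0 / c)"]) auto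
qed

lemma residuals_tendsto_0:
  shows "(\<lambda>k. X k - Xbar k) \<longlonglongrightarrow> 0" and "(\<lambda>k. \<Lambda> (Suc k) - \<Lambda> k) \<longlonglongrightarrow> 0"
proof -
  obtain w where w: "w \<in> saddles" using saddle_ex by blast
  obtain j where j: "0 < j" "\<And>y. j * (norm y)\<^sup>2 \<le> y \<bullet> J y"
    using pos_def_imp_coercive[OF J_pos_def] by blast
  define a where "a = 1 / \<alpha> - L / 2"
  have a: "0 < a" using e_coeff_pos by (simp add: a_def)
  define gap where "gap k = lyapunov w k - lyapunov w (Suc k)" for k
  obtain v where "lyapunov w \<longlonglongrightarrow> v"
    using decseq_convergent[OF lyapunov_decseq[OF w], of 0] lyapunov_nonneg by blast
  \<comment> \<open>Consecutive differences of a convergent sequence tend to 0; both residuals are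
    controlled by them.\<close>
  then have gap0: "gap \<longlonglongrightarrow> 0"
    unfolding gap_def using tendsto_diff[OF _ LIMSEQ_Suc] by fastforce
  \<comment> \<open>Kept polymorphic because the two residuals live in different spaces.\<close>
  have sq_null: "z \<longlonglongrightarrow> 0" if "0 < c" "\<And>k. c * (norm (z k))\<^sup>2 \<le> gap k"
    for z :: "nat \<Rightarrow> 'c::real_normed_vector" and c
  proof -
    have "(\<lambda>k. (norm (z k))\<^sup>2) \<longlonglongrightarrow> 0"
    proof (rule tendsto_sandwich[OF always_eventually always_eventually tendsto_const])
      show "(\<lambda>k. gap k / c) \<longlonglongrightarrow> 0"
        using tendsto_divide[OF gap0 tendsto_const, of c] that(1) by simp
      show "\<forall>k. (norm (z k))\<^sup>2 \<le> gap k / c"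
        using that by (simp add: field_simps)
    qed simp
    then have "(\<lambda>k. sqrt ((norm (z k))\<^sup>2)) \<longlonglongrightarrow> sqrt 0" by (rule tendsto_real_sqrt)
    then show ?thesis by (simp add: tendsto_norm_zero_iff)
  qed
  have dec: "a * (norm (X k - Xbar k))\<^sup>2 + (\<Lambda> (Suc k) - \<Lambda> k) \<bullet> J (\<Lambda> (Suc k) - \<Lambda> k) \<le> gap k" for k
    using lyapunov_decrease[OF w, of k] by (simp add: gap_def a_def)
  show "(\<lambda>k. X k - Xbar k) \<longlonglongrightarrow> 0"
    using dec J_nonneg by (intro sq_null[OF a]) (smt (verit))
  show "(\<lambda>k. \<Lambda> (Suc k) - \<Lambda> k) \<longlonglongrightarrow> 0"
  proof (rule sq_null[OF j(1)])
    fix k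
    have "0 \<le> a * (norm (X k - Xbar k))\<^sup>2" using a by simp
    then show "j * (norm (\<Lambda> (Suc k) - \<Lambda> k))\<^sup>2 \<le> gap k"
      using dec[of k] j(2)[of "\<Lambda> (Suc k) - \<Lambda> k"] by linarith
  qed
qed

text \<open>The optimality conditions of the two steps are the saddle point conditions up to the
  residuals. As these vanish, \<open>Xbar\<close> has the same subsequential limit as X, and both
  conditions pass to the limit.\<close>

lemma cluster_point_saddle:
  assumes s: "strict_mono s" and X_lim: "(X \<circ> s) \<longlonglongrightarrow> p" and \<Lambda>_lim: "(\<Lambda> \<circ> s) \<longlonglongrightarrow> l"
  shows "(p, l) \<in> saddles"
proof -
  have bl: "bounded_linear A" "bounded_linear (adjoint A)" "bounded_linear Q"
    using A_linear adjoint_linear[OF A_linear] Q_linear by (simp_all add: linear_conv_bounded_linear)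
  have res: "(\<lambda>k. X (s k) - Xbar (s k)) \<longlonglongrightarrow> 0" "(\<lambda>k. \<Lambda> (Suc (s k)) - \<Lambda> (s k)) \<longlonglongrightarrow> 0"
    using residuals_tendsto_0[THEN LIMSEQ_subseq_LIMSEQ, OF s] by (simp_all add: o_def)
  have X': "(\<lambda>k. X (s k)) \<longlonglongrightarrow> p" and \<Lambda>': "(\<lambda>k. \<Lambda> (s k)) \<longlonglongrightarrow> l"
    using X_lim \<Lambda>_lim by (simp_all add: o_def)
  have Xbar': "(\<lambda>k. Xbar (s k)) \<longlonglongrightarrow> p"
    using tendsto_diff[OF X' res(1)] by simp
  have "(\<lambda>k. A (Xbar (s k)) - b) \<longlonglongrightarrow> A p - b"
    by (intro tendsto_intros bounded_linear.tendsto[OF bl(1)] Xbar')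
  moreover have "(\<lambda>k. A (Xbar (s k)) - b) \<longlonglongrightarrow> Q 0"
    using bounded_linear.tendsto[OF bl(3) res(2)] by (simp add: Q_increment)
  ultimately have "A p = b"
    using LIMSEQ_unique linear_0[OF Q_linear] by fastforce
  moreover have "subgradient R p (- (adjoint A l + G p))"
  proof (rule subgradient_closed[OF R_closed R_proper Xbar_subgradient Xbar'])
    have "isCont G p"
      using lipschitz_on_continuous_on[OF G_lipschitz]
      by (simp add: continuous_on_eq_continuous_at)
    then have "(\<lambda>k. G (X (s k))) \<longlonglongrightarrow> G p"
      using X' by (rule isCont_tendsto_compose)
    then have "(\<lambda>k. (1 / \<alpha>) *\<^sub>R (X (s k) - Xbar (s k)) - adjoint A (\<Lambda> (s k)) - G (X (s k)))
        \<longlonglongrightarrow> (1 / \<alpha>) *\<^sub>R 0 - adjoint A l - G p"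
      by (intro tendsto_intros bounded_linear.tendsto[OF bl(2)] res \<Lambda>')
    then show "(\<lambda>k. (1 / \<alpha>) *\<^sub>R (X (s k) - Xbar (s k)) - adjoint A (\<Lambda> (s k)) - G (X (s k)))
        \<longlonglongrightarrow> - (adjoint A l + G p)"
      by simp
  qed
  ultimately show ?thesis by (simp add: saddle_iff)
qed

lemma converges_to_saddle:
  "\<exists>w\<in>saddles. (\<lambda>k. (X k, \<Lambda> k)) \<longlonglongrightarrow> w"
proof -
  obtain w0 where w0: "w0 \<in> saddles" using saddle_ex by blast
  obtain C where C: "\<And>k. norm ((X k, \<Lambda> k) - w0) \<le> C"
    using distance_bounded[OF w0] by (auto simp: bounded_iff)
  have "bounded (range (\<lambda>k. (X k, \<Lambda> k)))"
  proof (rule boundedI)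
    fix z assume "z \<in> range (\<lambda>k. (X k, \<Lambda> k))"
    then obtain k where "z = (X k, \<Lambda> k)" by blast
    then show "norm z \<le> C + norm w0"
      using C[of k] norm_triangle_sub[of z w0] by simp
  qed
  then obtain w s where s: "strict_mono s" and lim: "((\<lambda>k. (X k, \<Lambda> k)) \<circ> s) \<longlonglongrightarrow> w"
    using bounded_imp_convergent_subsequence by blast
  have X_lim: "(X \<circ> s) \<longlonglongrightarrow> fst w" and \<Lambda>_lim: "(\<Lambda> \<circ> s) \<longlonglongrightarrow> snd w"
    using tendsto_fst[OF lim] tendsto_snd[OF lim] by (simp_all add: o_def)
  then have w: "w \<in> saddles"
    using cluster_point_saddle[OF s X_lim \<Lambda>_lim] by simp
  have "bounded_linear Q"
    using Q_linear by (simp add: linear_conv_bounded_linear)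
  \<comment> \<open>The limit is left in the unsimplified shape of \<open>lyapunov\<close>, so that
    the continuity rules apply term by term.\<close>
  then have "(\<lambda>k. lyapunov w (s k)) \<longlonglongrightarrow>
      (norm (fst w - fst w))\<^sup>2 / \<alpha> + (snd w - snd w) \<bullet> Q (snd w - snd w)"
    using X_lim \<Lambda>_lim \<alpha> unfolding lyapunov_def o_def
    by (intro tendsto_intros bounded_linear.tendsto[of Q]) auto
  then have sub0: "(\<lambda>k. lyapunov w (s k)) \<longlonglongrightarrow> 0" by simp
  obtain v where v: "lyapunov w \<longlonglongrightarrow> v"
    using decseq_convergent[OF lyapunov_decseq[OF w], of 0] lyapunov_nonneg by blast
  then have "(\<lambda>k. lyapunov w (s k)) \<longlonglongrightarrow> v"
    using LIMSEQ_subseq_LIMSEQ[OF v s] by (simp add: o_def)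
  then have lyap0: "lyapunov w \<longlonglongrightarrow> 0"
    using v sub0 LIMSEQ_unique by blast
  obtain c where c: "0 < c" "\<And>w k. c * (norm ((X k, \<Lambda> k) - w))\<^sup>2 \<le> lyapunov w k"
    using lyapunov_coercive by blast
  have "(\<lambda>k. (norm ((X k, \<Lambda> k) - w))\<^sup>2) \<longlonglongrightarrow> 0"
  proof (rule tendsto_sandwich[OF always_eventually always_eventually tendsto_const])
    show "(\<lambda>k. lyapunov w k / c) \<longlonglongrightarrow> 0"
      using tendsto_divide[OF lyap0 tendsto_const, of c] c(1) by simp
    show "\<forall>k. (norm ((X k, \<Lambda> k) - w))\<^sup>2 \<le> lyapunov w k / c"
      using c by (simp add: pos_le_divide_eq mult.commute)
  qed simp
  then have "(\<lambda>k. sqrt ((norm ((X k, \<Lambda> k) - w))\<^sup>2)) \<longlonglongrightarrow> sqrt 0"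
    by (rule tendsto_real_sqrt)
  then have "(\<lambda>k. (X k, \<Lambda> k) - w) \<longlonglongrightarrow> 0"
    by (simp only: real_sqrt_abs abs_norm_cancel real_sqrt_zero tendsto_norm_zero_iff)
  then show ?thesis
    using w by (auto simp: LIM_zero_iff)
qed

end

section \<open>Transfer to the lifted problem on pairs\<close>

lemma gderiv_lift_F:
  assumes "GDERIV f (fst Z) :> g"
  shows "GDERIV (lift_F f) Z :> (g, 0)"
proof -
  have "(f has_derivative (\<lambda>h. h \<bullet> g)) (at (fst Z))"
    using assms by (simp add: gderiv_def)
  moreover have "(fst has_derivative fst) (at Z)"
    by (intro bounded_linear_imp_has_derivative bounded_linear_fst)
  ultimately have "((\<lambda>Z. f (fst Z)) has_derivative (\<lambda>h. fst h \<bullet> g)) (at Z)"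
    by (rule has_derivative_compose[rotated])
  moreover have "(\<lambda>h. fst h \<bullet> g) = (\<lambda>h. h \<bullet> (g, 0))"
    by (simp add: fun_eq_iff inner_prod_def)
  ultimately show ?thesis
    unfolding gderiv_def lift_F_def by (rule has_derivative_eq_rhs)
qed

text \<open>As a preimage under a continuous linear map, the epigraph inherits closedness and
  convexity.\<close>

lemma ereal_epigraph_lift_R:
  "ereal_epigraph (lift_R r) = (\<lambda>w. (snd (fst w), snd w)) -` ereal_epigraph r"
  by (auto simp: ereal_epigraph_def lift_R_def)

lemma closed_fun_lift_R: "closed_fun r \<Longrightarrow> closed_fun (lift_R r)"
  unfolding closed_fun_def ereal_epigraph_lift_R
  by (intro closed_vimage continuous_intros)

lemma convex_fun_lift_R: "convex_fun r \<Longrightarrow> convex_fun (lift_R r)"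
  unfolding convex_fun_def ereal_epigraph_lift_R
  by (intro convex_linear_vimage) (auto intro!: linearI)

lemma proper_fun_lift_R: "proper_fun r \<Longrightarrow> proper_fun (lift_R r)"
  by (auto simp: proper_fun_def lift_R_def)

lemma convex_on_lift_F:
  assumes "convex_on UNIV f"
  shows "convex_on UNIV (lift_F f)"
  using assms by (auto simp: convex_on_def lift_F_def)

lemma linear_lift_D: "linear (lift_D B D)"
  by (rule linearI)
    (auto simp: lift_D_def matrix_vector_right_distrib matrix_vector_mult_scaleR scaleR_diff_right)

theorem theorem1:
  fixes f :: "real^'n \<Rightarrow> real" and r :: "real^'p1 \<Rightarrow> ereal"
    and B :: "real^'n^'p1" and D :: "real^'n^'p2" and d :: "real^'p2"
    and Q :: "(real^'p2) \<times> (real^'p1) \<Rightarrow> (real^'p2) \<times> (real^'p1)"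
    and L \<alpha> :: real
    and X Xbar :: "nat \<Rightarrow> (real^'n) \<times> (real^'p1)"
    and \<Lambda> :: "nat \<Rightarrow> (real^'p2) \<times> (real^'p1)"
  defines "F \<equiv> lift_F f"
    and "R \<equiv> lift_R r"
    and "DD \<equiv> lift_D B D"
    and "dd \<equiv> lift_d d"
  defines "Wstar \<equiv> saddle_points (lagrangian F R DD dd)"
    and "J \<equiv> (\<lambda>y. Q y - \<alpha> *\<^sub>R DD (adjoint DD y))"
  assumes solvable: "solution_set f r B D d \<noteq> {}"
    and f_convex: "convex_on UNIV f"
    and f_diff: "\<And>x. f differentiable (at x)"
    and L_pos: "L > 0"
    and f_grad: "L-lipschitz_on UNIV (gradient f)"
    and r_proper: "proper_fun r"
    and r_closed: "closed_fun r"
    and r_convex: "convex_fun r"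
    and strong_duality: "Wstar \<noteq> {}"
    and Q_self_adjoint: "self_adjoint Q"
    and Lambda_0: "\<Lambda> 0 = 0"
    and Xbar_step: "\<And>k. Xbar k = prox \<alpha> R (X k - \<alpha> *\<^sub>R (adjoint DD (\<Lambda> k) + gradient F (X k)))"
    and Lambda_step: "\<And>k. \<Lambda> (Suc k) =
          arg_min (\<lambda>y. 1 / 2 * sqnorm_wrt Q (y - \<Lambda> k) + y \<bullet> (dd - DD (Xbar k))) (\<lambda>y. True)"
    and X_step: "\<And>k. X (Suc k) = Xbar k + \<alpha> *\<^sub>R adjoint DD (\<Lambda> k - \<Lambda> (Suc k))"
    and alpha: "\<alpha> \<in> {0<..<2 / L}"
    and J_pos_def: "pos_def J"
  shows "(\<forall>Ws \<in> Wstar. bounded (range (\<lambda>k. norm ((X k, \<Lambda> k) - Ws))))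
       \<and> (\<exists>Winf \<in> Wstar. (\<lambda>k. (X k, \<Lambda> k)) \<longlonglongrightarrow> Winf)"
proof -
  have f_deriv: "GDERIV f x :> gradient f x" for x
    using f_diff by (rule gderiv_gradient)
  have F_deriv: "GDERIV F Z :> (gradient f (fst Z), 0)" for Z
    unfolding F_def using f_deriv by (rule gderiv_lift_F)
  then have gradF: "gradient F Z = (gradient f (fst Z), 0)" for Z
    by (rule gradient_eqI)
  \<comment> \<open>The constant L survives the lifting: the second block of the gradient is 0 and
    the projection to the first block is nonexpansive.\<close>
  have F_lip: "L-lipschitz_on UNIV (gradient F)"
  proof (rule lipschitz_onI)
    fix Z Z' :: "(real^'n) \<times> (real^'p1)"
    have "dist (gradient F Z) (gradient F Z') = dist (gradient f (fst Z)) (gradient f (fst Z'))"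
      by (simp add: gradF dist_Pair_Pair)
    also have "\<dots> \<le> L * dist (fst Z) (fst Z')"
      using f_grad by (rule lipschitz_onD) auto
    also have "\<dots> \<le> L * dist Z Z'"
      using L_pos by (intro mult_left_mono dist_fst_le) auto
    finally show "dist (gradient F Z) (gradient F Z') \<le> L * dist Z Z'" .
  qed (use L_pos in simp)
  interpret primal_dual_iteration F R DD dd Q "gradient F" L \<alpha> X Xbar \<Lambda>
  proof (intro primal_dual_iteration.intro)
    show "convex_on UNIV F" unfolding F_def using f_convex by (rule convex_on_lift_F)
    show "GDERIV F Z :> gradient F Z" for Z using F_deriv by (simp add: gradF)
    show "proper_fun R" unfolding R_def using r_proper by (rule proper_fun_lift_R)
    show "closed_fun R" unfolding R_def using r_closed by (rule closed_fun_lift_R)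
    show "convex_fun R" unfolding R_def using r_convex by (rule convex_fun_lift_R)
    show "linear DD" unfolding DD_def by (rule linear_lift_D)
    show "pos_def (\<lambda>y. Q y - \<alpha> *\<^sub>R DD (adjoint DD y))"
      using J_pos_def unfolding J_def .
    show "saddle_points (lagrangian F R DD dd) \<noteq> {}"
      using strong_duality unfolding Wstar_def .
    show "0 < \<alpha>" "\<alpha> < 2 / L" using alpha by auto
  qed (fact F_lip L_pos Q_self_adjoint Xbar_step Lambda_step X_step)+
  show ?thesis
    unfolding Wstar_def using distance_bounded converges_to_saddle by blast
qed

end
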